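(* Let $l \geq 1$ be an integer and let $F$ be an exact linear $l$-regular CNF formula with $m = |F|$ clauses and $n = |V(F)|$ variables. Then there is a positive integer $k$ such that $F$ is $k$-uniform, and either $k \equiv 1 \pmod{l}$ or $m \not\equiv 0 \pmod{l}$. Furthermore $$m = 1 + k(l-1), \qquad n = k^2 - \frac{k(k-1)}{l}.$$
   Context: A literal is a Boolean variable or its negation. A clause is a finite non-empty set (disjunction) of literals that does not contain both a variable and its negation; $V(C)$ is the set of variables occurring in the clause $C$. A CNF formula $F$ is a finite non-empty set (conjunction) of clauses; $|F|$ is its number of clauses and $V(F)$ the set of variables occurring in $F$. $F$ is exact linear if any two distinct clauses $C, C' \in F$ satisfy $|V(C) \cap V(C')| = 1$. $F$ is $l$-regular if every variable $x \in V(F)$ occurs (positively or negated) in exactly $l$ clauses of $F$. $F$ is $k$-uniform if every clause of $F$ contains exactly $k$ literals. *)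

theory Defs
  imports Complex_Main "HOL-Number_Theory.Cong"
begin

datatype 'a literal = Pos (var: 'a) | Neg (var: 'a)

type_synonym 'a clause = "'a literal set"

type_synonym 'a cnf = "'a clause set"

definition is_clause :: "'a clause \<Rightarrow> bool" where
  "is_clause C \<longleftrightarrow> finite C \<and> C \<noteq> {} \<and> \<not> (\<exists>x. Pos x \<in> C \<and> Neg x \<in> C)"

definition clause_vars :: "'a clause \<Rightarrow> 'a set" where
  "clause_vars C = var ` C"

definition is_cnf :: "'a cnf \<Rightarrow> bool" where
  "is_cnf F \<longleftrightarrow> finite F \<and> F \<noteq> {} \<and> (\<forall>C\<in>F. is_clause C)"

definition cnf_vars :: "'a cnf \<Rightarrow> 'a set" where
  "cnf_vars F = (\<Union>C\<in>F. clause_vars C)"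

definition exact_linear :: "'a cnf \<Rightarrow> bool" where
  "exact_linear F \<longleftrightarrow>
     (\<forall>C\<in>F. \<forall>C'\<in>F. C \<noteq> C' \<longrightarrow> card (clause_vars C \<inter> clause_vars C') = 1)"

definition regular :: "nat \<Rightarrow> 'a cnf \<Rightarrow> bool" where
  "regular l F \<longleftrightarrow> (\<forall>x\<in>cnf_vars F. card {C \<in> F. x \<in> clause_vars C} = l)"

definition uniform :: "nat \<Rightarrow> 'a cnf \<Rightarrow> bool" where
  "uniform k F \<longleftrightarrow> (\<forall>C\<in>F. card C = k)"

end

theory Submission imports Defs begin

text \<open>Double counting: the incidences between the variables of one fixed clause and all clauses
  determine the size of that clause from \<open>m\<close> and \<open>l\<close>, which gives uniformity
  (for \<open>l = 1\<close> there is only one clause); the incidences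
  between all variables and all clauses then give \<open>n l = m k\<close>.\<close>

text \<open>No variable occurs in a clause with both signs, so \<open>var\<close> is injective on
  it. This links \<open>uniform\<close>, which counts literals, to the incidence counts, which
  concern variables.\<close>

lemma card_clause_vars:
  assumes "is_clause C"
  shows "card (clause_vars C) = card C"
proof -
  have "inj_on var C"
  proof (rule inj_onI)
    fix a b assume "a \<in> C" "b \<in> C" "var a = var b"
    with assms show "a = b"
      unfolding is_clause_def by (cases a; cases b) auto
  qed
  then show ?thesis
    unfolding clause_vars_def by (rule card_image)
qed

lemma finite_clause_vars: "is_clause C \<Longrightarrow> finite (clause_vars C)"
  by (simp add: is_clause_def clause_vars_def)

text \<open>Count pairs of a variable in \<open>V\<close> and a clause containing it: each variable
  contributes \<open>l\<close>. \<open>V\<close> is left general to cover both one clause and the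
  whole formula.\<close>

lemma regular_incidence_count:
  assumes "is_cnf F" "regular l F" "V \<subseteq> cnf_vars F"
  shows "(\<Sum>D\<in>F. card (V \<inter> clause_vars D)) = l * card V"
proof -
  have fin: "finite F" "finite (cnf_vars F)"
    using assms(1) by (auto simp: is_cnf_def cnf_vars_def finite_clause_vars)
  then have "finite V"
    using assms(3) finite_subset by blast
  then have "(\<Sum>D\<in>F. card {x\<in>V. x \<in> clause_vars D}) = l * card V"
    using assms(2,3) fin(1) by (intro sum_multicount) (auto simp: regular_def)
  then show ?thesis
    by (simp add: Int_def)
qed

text \<open>Count incidences with \<open>V = clause_vars C\<close>: \<open>C\<close> itself
  contributes \<open>card C\<close>, and every other clause exactly 1 by exact linearity. The
  additive form avoids truncated subtraction.\<close>

lemma exact_linear_regular_card: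
  assumes "is_cnf F" "exact_linear F" "regular l F" "C \<in> F"
  shows "card F + card C = 1 + l * card C"
proof -
  have fin: "finite F" and C: "is_clause C"
    using assms(1,4) by (auto simp: is_cnf_def)
  have "l * card C = (\<Sum>D\<in>F. card (clause_vars C \<inter> clause_vars D))"
  proof -
    have "clause_vars C \<subseteq> cnf_vars F"
      using assms(4) by (auto simp: cnf_vars_def)
    then show ?thesis
      using assms(1,3) by (simp add: regular_incidence_count card_clause_vars[OF C])
  qed
  also have "\<dots> = card C + (\<Sum>D\<in>F - {C}. card (clause_vars C \<inter> clause_vars D))"
    using fin assms(4) by (simp add: sum.remove card_clause_vars[OF C])
  also have "(\<Sum>D\<in>F - {C}. card (clause_vars C \<inter> clause_vars D)) = (\<Sum>D\<in>F - {C}. 1)"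
    using assms(2,4) by (intro sum.cong) (auto simp: exact_linear_def)
  also have "\<dots> = card F - 1"
    using fin assms(4) by simp
  finally have "l * card C = card C + (card F - 1)" .
  moreover have "card F > 0"
    using fin assms(4) card_gt_0_iff by blast
  ultimately show ?thesis
    by linarith
qed

lemma exact_linear_regular_uniform:
  assumes "is_cnf F" "exact_linear F" "regular l F" "C \<in> F"
  shows "uniform (card C) F"
  unfolding uniform_def
proof
  fix D assume D: "D \<in> F"
  have fin: "finite F"
    using assms(1) by (simp add: is_cnf_def)
  have cards: "card F + card C = 1 + l * card C" "card F + card D = 1 + l * card D"
    using exact_linear_regular_card[OF assms(1-3)] assms(4) D by auto
  show "card D = card C"
  proof (cases "l = 1")
    case True
    \<comment> \<open>Here the equation leaves the clause size open but fixes the number of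
      clauses.\<close>
    with cards have "card F = 1" by simp
    with assms(4) D show ?thesis
      by (auto simp: card_1_singleton_iff)
  next
    case False
    \<comment> \<open>Both sides equal \<open>card F - 1\<close>; over the integers the nonzero
      factor \<open>int l - 1\<close> cancels.\<close>
    from cards have "(int l - 1) * int (card C) = (int l - 1) * int (card D)"
      by (simp add: algebra_simps flip: of_nat_mult of_nat_add)
    with False show ?thesis by simp
  qed
qed

lemma uniform_regular_card:
  assumes "is_cnf F" "regular l F" "uniform k F"
  shows "card F * k = l * card (cnf_vars F)"
proof -
  have "card F * k = (\<Sum>D\<in>F. card (cnf_vars F \<inter> clause_vars D))"
  proof -
    have "card (cnf_vars F \<inter> clause_vars D) = k" if "D \<in> F" for D
    proof -
      have "cnf_vars F \<inter> clause_vars D = clause_vars D"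
        using that by (auto simp: cnf_vars_def)
      then show ?thesis
        using that assms(1,3) by (simp add: card_clause_vars is_cnf_def uniform_def)
    qed
    then show ?thesis by simp
  qed
  then show ?thesis
    using regular_incidence_count[OF assms(1,2) order_refl] by simp
qed

theorem theorem3:
  fixes F :: "'a cnf" and l m n :: nat
  assumes "l \<ge> 1"
    and "is_cnf F"
    and "exact_linear F"
    and "regular l F"
    and "m = card F"
    and "n = card (cnf_vars F)"
  shows "\<exists>k::nat. k > 0 \<and> uniform k F
    \<and> ([k = 1] (mod l) \<or> \<not> [m = 0] (mod l))
    \<and> real m = 1 + real k * (real l - 1)
    \<and> real n = real k ^ 2 - real k * (real k - 1) / real l"
proof -
  obtain C where C: "C \<in> F"
    using assms(2) by (auto simp: is_cnf_def)
  define k where "k = card C"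
  have "k > 0"
    using C assms(2) by (auto simp: k_def is_cnf_def is_clause_def card_gt_0_iff)
  have unif: "uniform k F"
    unfolding k_def using assms(2-4) C by (rule exact_linear_regular_uniform)
  have mk: "m + k = 1 + l * k"
    unfolding k_def assms(5) using assms(2-4) C by (rule exact_linear_regular_card)
  have nl: "m * k = l * n"
    unfolding assms(5,6) using assms(2,4) unif by (rule uniform_regular_card)
  \<comment> \<open>The disjunction is proved as an implication: if \<open>l\<close> divides
    \<open>m\<close>, then \<open>k\<close> is congruent to \<open>m + k = 1 + l * k\<close>, hence
    to 1.\<close>
  have "[k = 1] (mod l)" if "[m = 0] (mod l)"
  proof -
    have "[0 + k = m + k] (mod l)"
      using that by (intro cong_add cong_refl) (rule cong_sym)
    also have "[m + k = 1] (mod l)"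
      unfolding mk cong_def by (rule mod_mult_self2)
    finally show ?thesis by simp
  qed
  moreover have m: "real m = 1 + real k * (real l - 1)"
    using arg_cong[OF mk, of real] by (simp add: algebra_simps)
  moreover have "real n = real k ^ 2 - real k * (real k - 1) / real l"
  proof -
    have "real l * real n = real m * real k"
      using arg_cong[OF nl, of real] by simp
    \<comment> \<open>Substituting \<open>m\<close> gives \<open>l * n = k + k^2 * (l - 1)\<close>;
      it remains to divide by \<open>l\<close>, which is nonzero.\<close>
    then show ?thesis
      using assms(1) by (simp add: m field_simps power2_eq_square)
  qed
  ultimately show ?thesis
    using \<open>k > 0\<close> unif by blast
qed

end
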